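(* Let $\alpha^+,\lambda^+,\alpha^-,\lambda^->0$ and let $f$ be the density of the bilateral Gamma distribution with parameters $(\alpha^+,\lambda^+;\alpha^-,\lambda^-)$. Let $N\in\mathbb{N}_0=\{0,1,2,\ldots\}$ be the unique nonnegative integer satisfying $N<\alpha^++\alpha^-\leq N+1$. Then $f\in C^N(\mathbb{R}\setminus\{0\})$ and $f\in C^{N-1}(\mathbb{R})\setminus C^N(\mathbb{R})$.
   Context: For $\alpha,\lambda>0$, $\Gamma(\alpha,\lambda)$ denotes the Gamma distribution with density $\frac{\lambda^\alpha}{\Gamma(\alpha)}x^{\alpha-1}e^{-\lambda x}$ on $(0,\infty)$. The bilateral Gamma distribution with parameters $(\alpha^+,\lambda^+;\alpha^-,\lambda^-)$, all $>0$, is the distribution of $X-Y$ where $X\sim\Gamma(\alpha^+,\lambda^+)$ and $Y\sim\Gamma(\alpha^-,\lambda^-)$ are independent. Its density $f(x)=f(x;\alpha^+,\lambda^+,\alpha^-,\lambda^-)$ is given for $x>0$ by $$f(x)=\frac{(\lambda^+)^{\alpha^+}(\lambda^-)^{\alpha^-}}{(\lambda^++\lambda^-)^{\alpha^-}\Gamma(\alpha^+)\Gamma(\alpha^-)}e^{-\lambda^+x}\int_0^\infty v^{\alpha^--1}\Big(x+\frac{v}{\lambda^++\lambda^-}\Big)^{\alpha^+-1}e^{-v}\,dv,$$ and for $x<0$ by $f(x;\alpha^+,\lambda^+,\alpha^-,\lambda^-)=f(-x;\alpha^-,\lambda^-,\alpha^+,\lambda^+)$. The value $f(0)$ is taken to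 be the continuous extension whenever one exists (otherwise it is arbitrary). $C^0$ denotes continuous functions, $C^n$ ($n\ge1$) denotes $n$ times continuously differentiable functions, and membership in $C^{-1}(\mathbb{R})$ (the case $N=0$) is an empty condition. *)

theory Defs
  imports "HOL-Analysis.Analysis"
begin

definition gamma_density :: "real \<Rightarrow> real \<Rightarrow> real \<Rightarrow> real" where
  "gamma_density a l x =
     (if 0 < x then l powr a / Gamma a * x powr (a - 1) * exp (- l * x) else 0)"

definition gamma_distribution :: "real \<Rightarrow> real \<Rightarrow> real measure" where
  "gamma_distribution a l = density lborel (\<lambda>x. ennreal (gamma_density a l x))"

definition bilateral_gamma :: "real \<Rightarrow> real \<Rightarrow> real \<Rightarrow> real \<Rightarrow> real measure" where
  "bilateral_gamma ap lp am lm =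
     distr (gamma_distribution ap lp \<Otimes>\<^sub>M gamma_distribution am lm) borel (\<lambda>(x, y). x - y)"

text \<open>The density on the positive half-line only (the integrand degenerates for \<open>x \<le> 0\<close>);
  see \<open>bilateral_gamma_eq_density\<close> for the link with \<open>bilateral_gamma\<close>. Throughout,
  \<open>ap, lp, am, lm\<close> stand for \<open>\<alpha>\<^sup>+, \<lambda>\<^sup>+, \<alpha>\<^sup>-, \<lambda>\<^sup>-\<close>.\<close>

definition bilateral_gamma_formula :: "real \<Rightarrow> real \<Rightarrow> real \<Rightarrow> real \<Rightarrow> real \<Rightarrow> real" where
  "bilateral_gamma_formula ap lp am lm x =
     lp powr ap * lm powr am / ((lp + lm) powr am * Gamma ap * Gamma am) * exp (- lp * x) *
     (LBINT v:{0<..}. v powr (am - 1) * (x + v / (lp + lm)) powr (ap - 1) * exp (- v))"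

text \<open>The value at the origin is the continuous extension if there is one and is left
  unconstrained otherwise, so this is a predicate rather than a function.\<close>

definition is_bilateral_gamma_density ::
    "real \<Rightarrow> real \<Rightarrow> real \<Rightarrow> real \<Rightarrow> (real \<Rightarrow> real) \<Rightarrow> bool" where
  "is_bilateral_gamma_density ap lp am lm f \<longleftrightarrow>
     (\<forall>x>0. f x = bilateral_gamma_formula ap lp am lm x) \<and>
     (\<forall>x<0. f x = bilateral_gamma_formula am lm ap lp (- x)) \<and>
     (\<forall>l. (f \<longlongrightarrow> l) (at 0) \<longrightarrow> f 0 = l)"

text \<open>The class \<open>C\<^sup>n(S)\<close>. Meaningful only for open \<open>S\<close>: the iterated two-sided derivatives
  on \<open>S\<close> are then determined by the values on \<open>S\<close>.\<close>

definition Cn_on :: "nat \<Rightarrow> real set \<Rightarrow> (real \<Rightarrow> real) \<Rightarrow> bool" where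
  "Cn_on n S f \<longleftrightarrow>
     (\<forall>k<n. \<forall>x\<in>S. (deriv ^^ k) f field_differentiable (at x)) \<and>
     continuous_on S ((deriv ^^ n) f)"

lemma gamma_density_nonneg: "a > 0 \<Longrightarrow> 0 \<le> gamma_density a l x"
  by (auto simp: gamma_density_def Gamma_real_pos less_imp_le)

lemma gamma_density_measurable [measurable]: "gamma_density a l \<in> borel_measurable borel"
  unfolding gamma_density_def [abs_def] by measurable

lemma bilateral_gamma_formula_measurable [measurable]:
  "bilateral_gamma_formula ap lp am lm \<in> borel_measurable borel"
  unfolding bilateral_gamma_formula_def [abs_def] set_lebesgue_integral_def by measurable

lemma Gamma_integrand_integrable:
  assumes "a > (0::real)"
  shows "set_integrable lborel {0<..} (\<lambda>v. v powr (a - 1) * exp (- v))"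
proof -
  have "integrable lborel (\<lambda>t. indicator {0..} t * t powr (a - 1) / exp t)"
    by (intro integrableI_nonneg)
       (auto simp: Gamma_conv_nn_integral_real[OF assms, symmetric])
  then have "integrable lborel (\<lambda>v. indicator {0<..} v *\<^sub>R (v powr (a - 1) * exp (- v)))"
    by (rule Bochner_Integration.integrable_bound)
       (auto simp: indicator_def exp_minus field_simps)
  then show ?thesis by (simp add: set_integrable_def)
qed

lemma bilateral_gamma_integrand_integrable:
  assumes "am > (0::real)" "x > 0" "L > 0"
  shows "set_integrable lborel {0<..} (\<lambda>v. v powr (am - 1) * (x + v / L) powr (ap - 1) * exp (- v))"
proof -
  define C where "C = (if ap \<le> 1 then x powr (ap - 1) else (2 * x) powr (ap - 1))"
  define D where "D = (if ap \<le> 1 then 0 else (2 / L) powr (ap - 1))"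
  define p where "p = (if ap \<le> 1 then 1 else ap)"
  have bnd: "(x + v / L) powr (ap - 1) \<le> C + D * v powr (p - 1)" if v: "v > 0" for v
  proof (cases "ap \<le> 1")
    case True
    have "(x + v / L) powr (ap - 1) \<le> x powr (ap - 1)"
      using True v assms by (intro powr_mono2') auto
    then show ?thesis using True by (simp add: C_def D_def)
  next
    case False
    have "x + v / L \<le> max (2 * x) (2 / L * v)" by auto
    then have "(x + v / L) powr (ap - 1) \<le> (max (2 * x) (2 / L * v)) powr (ap - 1)"
      using False v assms by (intro powr_mono2) auto
    also have "\<dots> \<le> (2 * x) powr (ap - 1) + (2 / L * v) powr (ap - 1)"
      by (auto simp: max_def)
    also have "(2 / L * v) powr (ap - 1) = (2 / L) powr (ap - 1) * v powr (ap - 1)"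
      using v assms by (subst powr_mult) auto
    finally show ?thesis using False by (simp add: C_def D_def p_def)
  qed
  have CD: "C \<ge> 0" "D \<ge> 0" by (auto simp: C_def D_def)
  have p: "p \<ge> 1" by (auto simp: p_def)
  have 1: "set_integrable lborel {0<..} (\<lambda>v. C * (v powr (am - 1) * exp (- v)) +
              D * (v powr (am + p - 1 - 1) * exp (- v)))"
    using assms p
    by (intro set_integral_add set_integrable_mult_right Gamma_integrand_integrable) auto
  show ?thesis unfolding set_integrable_def
  proof (rule Bochner_Integration.integrable_bound[OF 1[unfolded set_integrable_def]])
    show "AE v in lborel. norm (indicator {0<..} v *\<^sub>R
            (v powr (am - 1) * (x + v / L) powr (ap - 1) * exp (- v))) \<le>
          norm (indicator {0<..} v *\<^sub>R (C * (v powr (am - 1) * exp (- v)) +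
              D * (v powr (am + p - 1 - 1) * exp (- v))))"
    proof (intro AE_I2)
      fix v :: real
      show "norm (indicator {0<..} v *\<^sub>R
            (v powr (am - 1) * (x + v / L) powr (ap - 1) * exp (- v))) \<le>
          norm (indicator {0<..} v *\<^sub>R (C * (v powr (am - 1) * exp (- v)) +
              D * (v powr (am + p - 1 - 1) * exp (- v))))"
      proof (cases "v > 0")
        case True
        have "v powr (am - 1) * exp (- v) * (x + v / L) powr (ap - 1) \<le>
              v powr (am - 1) * exp (- v) * (C + D * v powr (p - 1))"
          using bnd[OF True] by (intro mult_left_mono) auto
        also have "v powr (am + p - 1 - 1) = v powr (am - 1) * v powr (p - 1)"
          by (simp add: powr_add [symmetric] algebra_simps)
        then have "v powr (am - 1) * exp (- v) * (C + D * v powr (p - 1)) =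
           C * (v powr (am - 1) * exp (- v)) + D * (v powr (am + p - 1 - 1) * exp (- v))"
          by (simp add: algebra_simps)
        finally show ?thesis using True CD by (simp add: abs_mult mult_ac)
      qed auto
    qed
  qed simp
qed

lemma nn_integral_bilateral_gamma_formula:
  assumes pos: "ap > 0" "lp > 0" "am > 0" "lm > 0" and x: "x > 0"
  shows "(\<integral>\<^sup>+y. ennreal (gamma_density am lm y * gamma_density ap lp (x + y)) \<partial>lborel) =
         ennreal (bilateral_gamma_formula ap lp am lm x)"
proof -
  define L where "L = lp + lm"
  have L: "L > 0" using pos by (simp add: L_def)
  define h where "h = (\<lambda>v. v powr (am - 1) * (x + v / L) powr (ap - 1) * exp (- v))"
  define K where "K = lp powr ap * lm powr am / (L powr am * Gamma ap * Gamma am) * exp (- lp * x)"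
  have K: "K \<ge> 0" using pos by (simp add: K_def Gamma_real_pos less_imp_le)
  have h [measurable]: "h \<in> borel_measurable borel" unfolding h_def by measurable
  have int: "integrable lborel (\<lambda>v. indicator {0<..} v *\<^sub>R h v)"
    using bilateral_gamma_integrand_integrable[of am x L ap] pos x L
    by (simp add: h_def set_integrable_def)
  have eq: "1 / L * (gamma_density am lm (0 + 1 / L * v) * gamma_density ap lp (x + (0 + 1 / L * v)))
            = K * (indicator {0<..} v *\<^sub>R h v)" for v
  proof (cases "v > 0")
    case True
    have xv: "x + v / L > 0" using True x L by (simp add: add_pos_pos)
    have e: "exp (- lm * (v / L)) * exp (- lp * (x + v / L)) = exp (- lp * x) * exp (- v)"
    proof -
      have "- lm * (v / L) + - lp * (x + v / L) = - lp * x - (lp + lm) * v / L"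
        using L by (simp add: field_simps)
      also have "\<dots> = - lp * x + - v" using L by (simp add: L_def)
      finally show ?thesis by (simp only: exp_add [symmetric])
    qed
    have q: "1 / L * (v / L) powr (am - 1) = v powr (am - 1) / L powr am"
      using True L by (simp add: powr_divide powr_diff field_simps)
    have "1 / L * (gamma_density am lm (v / L) * gamma_density ap lp (x + v / L)) =
      (1 / L * (v / L) powr (am - 1)) * (exp (- lm * (v / L)) * exp (- lp * (x + v / L))) *
      (lm powr am / Gamma am * (lp powr ap / Gamma ap)) * (x + v / L) powr (ap - 1)"
      using True L xv by (simp add: gamma_density_def)
    also have "\<dots> = K * h v"
      unfolding e q K_def h_def by (simp add: field_simps)
    finally show ?thesis using True by simp
  next
    case False
    then have "\<not> 0 < v / L" using L by (simp add: field_simps)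
    then show ?thesis using False by (simp add: gamma_density_def)
  qed
  have "(\<integral>\<^sup>+y. ennreal (gamma_density am lm y * gamma_density ap lp (x + y)) \<partial>lborel) =
     ennreal \<bar>1 / L\<bar> * (\<integral>\<^sup>+v. ennreal (gamma_density am lm (0 + 1 / L * v) *
                                gamma_density ap lp (x + (0 + 1 / L * v))) \<partial>lborel)"
    using L by (intro nn_integral_real_affine) auto
  also have "\<dots> = (\<integral>\<^sup>+v. ennreal (1 / L) * ennreal (gamma_density am lm (0 + 1 / L * v) *
                                gamma_density ap lp (x + (0 + 1 / L * v))) \<partial>lborel)"
    using L by (subst nn_integral_cmult) auto
  also have "\<dots> = (\<integral>\<^sup>+v. ennreal (K * (indicator {0<..} v *\<^sub>R h v)) \<partial>lborel)"
  proof (intro nn_integral_cong)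
    fix v :: real
    have "0 \<le> 1 / L" using L by simp
    then show "ennreal (1 / L) * ennreal (gamma_density am lm (0 + 1 / L * v) *
            gamma_density ap lp (x + (0 + 1 / L * v))) = ennreal (K * (indicator {0<..} v *\<^sub>R h v))"
      by (simp only: eq [symmetric] ennreal_mult' [symmetric])
  qed
  also have "\<dots> = ennreal (\<integral>v. K * (indicator {0<..} v *\<^sub>R h v) \<partial>lborel)"
    using int K by (intro nn_integral_eq_integral integrable_mult_right)
      (auto simp: h_def indicator_def)
  also have "(\<integral>v. K * (indicator {0<..} v *\<^sub>R h v) \<partial>lborel) = bilateral_gamma_formula ap lp am lm x"
    by (simp add: bilateral_gamma_formula_def K_def h_def L_def set_lebesgue_integral_def)
  finally show ?thesis .
qed

lemma bilateral_gamma_eq_density: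
  assumes pos: "ap > 0" "lp > 0" "am > 0" "lm > 0"
    and f: "is_bilateral_gamma_density ap lp am lm f"
  shows "bilateral_gamma ap lp am lm = density lborel (\<lambda>x. ennreal (f x))"
proof -
  let ?p = "gamma_density ap lp" and ?m = "gamma_density am lm"
  have fdef: "f = (\<lambda>x. if x > 0 then bilateral_gamma_formula ap lp am lm x else
                      if x < 0 then bilateral_gamma_formula am lm ap lp (- x) else f 0)"
    using f by (auto simp: is_bilateral_gamma_density_def fun_eq_iff not_less)
  have f_meas [measurable]: "f \<in> borel_measurable borel" by (subst fdef) measurable
  have conv: "(\<integral>\<^sup>+y. ennreal (?m y * ?p (x + y)) \<partial>lborel) = ennreal (f x)" if "x \<noteq> 0" for x
  proof (cases "x > 0")
    case True
    then show ?thesis using f nn_integral_bilateral_gamma_formula[OF pos True]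
      by (simp add: is_bilateral_gamma_density_def)
  next
    case False
    then have x: "- x > 0" using that by simp
    have "(\<integral>\<^sup>+y. ennreal (?m y * ?p (x + y)) \<partial>lborel) =
          ennreal \<bar>1\<bar> * (\<integral>\<^sup>+y. ennreal (?m (- x + 1 * y) * ?p (x + (- x + 1 * y))) \<partial>lborel)"
      by (intro nn_integral_real_affine) auto
    also have "\<dots> = (\<integral>\<^sup>+y. ennreal (?p y * ?m (- x + y)) \<partial>lborel)"
      by (simp add: mult.commute)
    also have "\<dots> = ennreal (bilateral_gamma_formula am lm ap lp (- x))"
      by (rule nn_integral_bilateral_gamma_formula) (use pos x in auto)
    finally show ?thesis using x f by (simp add: is_bilateral_gamma_density_def)
  qed
  show ?thesis
  proof (rule measure_eqI)
    show "sets (bilateral_gamma ap lp am lm) = sets (density lborel (\<lambda>x. ennreal (f x)))"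
      by (simp add: bilateral_gamma_def)
    fix A assume "A \<in> sets (bilateral_gamma ap lp am lm)"
    then have A [measurable]: "A \<in> sets borel" by (simp add: bilateral_gamma_def)
    have [measurable_cong]: "sets (gamma_distribution a l) = sets borel" for a l
      by (simp add: gamma_distribution_def)
    have sf: "sigma_finite_measure (density lborel (\<lambda>x. ennreal (?m x)))"
      by (subst sigma_finite_measure.sigma_finite_iff_density_finite[OF lborel.sigma_finite_measure_axioms]) auto
    have prod: "gamma_distribution ap lp \<Otimes>\<^sub>M gamma_distribution am lm =
          density (lborel \<Otimes>\<^sub>M lborel) (\<lambda>(x, y). ennreal (?p x) * ennreal (?m y))"
      unfolding gamma_distribution_def
      by (intro pair_measure_density lborel.sigma_finite_measure_axioms sf) auto
    have "emeasure (bilateral_gamma ap lp am lm) A =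
          (\<integral>\<^sup>+z. indicator A z \<partial>bilateral_gamma ap lp am lm)"
      by (subst nn_integral_indicator) (auto simp: bilateral_gamma_def)
    also have "\<dots> = (\<integral>\<^sup>+w. indicator A (case w of (x, y) \<Rightarrow> x - y)
                   \<partial>(gamma_distribution ap lp \<Otimes>\<^sub>M gamma_distribution am lm))"
      unfolding bilateral_gamma_def by (rule nn_integral_distr) measurable
    also have "\<dots> = (\<integral>\<^sup>+w. (case w of (x, y) \<Rightarrow> ennreal (?p x) * ennreal (?m y)) *
                     indicator A (case w of (x, y) \<Rightarrow> x - y) \<partial>(lborel \<Otimes>\<^sub>M lborel))"
      unfolding prod by (rule nn_integral_density) measurable
    also have "\<dots> = (\<integral>\<^sup>+y. \<integral>\<^sup>+x. ennreal (?p x) * ennreal (?m y) * indicator A (x - y) \<partial>lborel \<partial>lborel)"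
      by (subst lborel_pair.nn_integral_snd [symmetric]) (simp_all add: case_prod_unfold)
    also have "\<dots> = (\<integral>\<^sup>+y. \<integral>\<^sup>+z. ennreal (?m y * ?p (z + y)) * indicator A z \<partial>lborel \<partial>lborel)"
    proof (rule nn_integral_cong)
      fix y :: real
      have "(\<integral>\<^sup>+x. ennreal (?p x) * ennreal (?m y) * indicator A (x - y) \<partial>lborel) =
        ennreal \<bar>1\<bar> * (\<integral>\<^sup>+x. ennreal (?p (y + 1 * x)) * ennreal (?m y) * indicator A (y + 1 * x - y) \<partial>lborel)"
        by (rule nn_integral_real_affine) auto
      then show "(\<integral>\<^sup>+x. ennreal (?p x) * ennreal (?m y) * indicator A (x - y) \<partial>lborel) =
            (\<integral>\<^sup>+z. ennreal (?m y * ?p (z + y)) * indicator A z \<partial>lborel)"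
        using pos by (simp add: ennreal_mult gamma_density_nonneg mult_ac add_ac)
    qed
    also have "\<dots> = (\<integral>\<^sup>+z. \<integral>\<^sup>+y. ennreal (?m y * ?p (z + y)) * indicator A z \<partial>lborel \<partial>lborel)"
      by (rule lborel_pair.Fubini') simp
    also have "\<dots> = (\<integral>\<^sup>+z. (\<integral>\<^sup>+y. ennreal (?m y * ?p (z + y)) \<partial>lborel) * indicator A z \<partial>lborel)"
      by (intro nn_integral_cong nn_integral_multc) auto
    also have "\<dots> = (\<integral>\<^sup>+z. ennreal (f z) * indicator A z \<partial>lborel)"
      using AE_lborel_singleton[of "0::real"]
      by (intro nn_integral_cong_AE) (auto elim!: eventually_mono simp: conv)
    also have "\<dots> = emeasure (density lborel (\<lambda>x. ennreal (f x))) A"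
      by (subst emeasure_density) auto
    finally show "emeasure (bilateral_gamma ap lp am lm) A =
                  emeasure (density lborel (\<lambda>x. ennreal (f x))) A" .
  qed
qed

end

theory Submission
  imports Defs "HOL-Real_Asymp.Real_Asymp"
begin

text \<open>Write \<open>f\<^bsub>a,b\<^esub>\<close> for the density with shape parameters \<open>a = ap\<close>, \<open>b = am\<close>. If \<open>a > 1\<close>, then
  \<open>f\<^bsub>a,b\<^esub>' = lp (f\<^bsub>a-1,b\<^esub> - f\<^bsub>a,b\<^esub>)\<close> away from the origin (differentiate under the integral for \<open>x > 0\<close>,
  and additionally integrate by parts for \<open>x < 0\<close>). Hence \<open>f\<^bsub>a,b\<^esub>\<close> is exactly one order smoother at the
  origin than \<open>f\<^bsub>a-1,b\<^esub>\<close>, and by reflection the same holds for \<open>b > 1\<close>. This reduces the claim to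
  \<open>a, b \<le> 1\<close>. There, if \<open>a + b \<le> 1\<close>, the density grows at least like \<open>- ln x\<close> as \<open>x \<rightarrow> 0+\<close>. If
  \<open>a + b > 1\<close>, it is continuous at the origin with \<open>f 0 > 0\<close>, and \<open>e\<^bsup>lp x\<^esup> f x\<close> is at most \<open>f 0\<close>
  for \<open>x > 0\<close>, so that a derivative at the origin would be negative; by reflection it would also be
  positive.\<close>

section \<open>Functions of class \<open>C\<^sup>n\<close>\<close>

lemma Cn_on_0: "Cn_on 0 S f \<longleftrightarrow> continuous_on S f"
  by (simp add: Cn_on_def)

lemma Cn_on_Suc:
  "Cn_on (Suc n) S f \<longleftrightarrow> (\<forall>x\<in>S. f field_differentiable (at x)) \<and> Cn_on n S (deriv f)"
  unfolding Cn_on_def by (auto simp: less_Suc_eq_0_disj funpow_swap1 simp del: funpow.simps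
      simp: funpow_Suc_right)

text \<open>Agreement on an open set is agreement near each of its points, so all iterated two-sided
  derivatives agree there as well. This allows a density to be replaced by its formula on each open
  half-line.\<close>

lemma Cn_on_cong:
  assumes "open S" and eq: "\<And>x. x \<in> S \<Longrightarrow> f x = g x"
  shows "Cn_on n S f \<longleftrightarrow> Cn_on n S g"
proof -
  have ev: "\<forall>\<^sub>F y in nhds x. f y = g y" if "x \<in> S" for x
    using eventually_nhds_in_open[OF \<open>open S\<close> that] by eventually_elim (rule eq)
  have deriv_eq: "(deriv ^^ k) f x = (deriv ^^ k) g x" if "x \<in> S" for k x
    using ev[OF that] by (rule higher_deriv_cong_ev) simp
  have "(deriv ^^ k) f field_differentiable at x \<longleftrightarrow> (deriv ^^ k) g field_differentiable at x"
    if "x \<in> S" for k x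
    using that \<open>open S\<close> deriv_eq unfolding field_differentiable_def
    by (intro ex_cong1 DERIV_cong_ev refl)
       (auto intro: eventually_mono[OF eventually_nhds_in_open[OF \<open>open S\<close> that]])
  then show ?thesis
    unfolding Cn_on_def using deriv_eq by (auto cong: continuous_on_cong)
qed

lemma Cn_on_SucI:
  assumes "open S" and der: "\<And>x. x \<in> S \<Longrightarrow> (f has_real_derivative g x) (at x)" and "Cn_on n S g"
  shows "Cn_on (Suc n) S f"
  unfolding Cn_on_Suc
proof
  show "\<forall>x\<in>S. f field_differentiable at x"
    using der by (auto simp: field_differentiable_def)
  show "Cn_on n S (deriv f)"
    using Cn_on_cong[of S "deriv f" g n] assms DERIV_imp_deriv[OF der] by simp
qed

lemma Cn_on_SucD: "Cn_on (Suc n) S f \<Longrightarrow> Cn_on n S f"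
proof (induction n arbitrary: f)
  case 0
  then show ?case
    by (auto simp: Cn_on_0 Cn_on_Suc intro!: continuous_at_imp_continuous_on
        field_differentiable_imp_continuous_at)
next
  case (Suc n)
  then show ?case by (subst (asm) Cn_on_Suc, subst Cn_on_Suc) blast
qed

lemma Cn_on_imp_continuous_on: "Cn_on n S f \<Longrightarrow> continuous_on S f"
  by (induction n) (auto simp: Cn_on_0 dest: Cn_on_SucD)

lemma Cn_on_linear_combination:
  assumes "open S" "Cn_on n S f" "Cn_on n S g"
  shows "Cn_on n S (\<lambda>x. c * f x + d * g x)"
  using assms(2,3)
proof (induction n arbitrary: f g)
  case 0
  then show ?case by (auto simp: Cn_on_0 intro!: continuous_intros)
next
  case (Suc n)
  show ?case
  proof (rule Cn_on_SucI)
    show "Cn_on n S (\<lambda>x. c * deriv f x + d * deriv g x)"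
      using Suc by (auto simp: Cn_on_Suc)
    show "((\<lambda>x. c * f x + d * g x) has_real_derivative c * deriv f x + d * deriv g x) (at x)"
      if "x \<in> S" for x
      using Suc.prems that
      by (auto simp: Cn_on_Suc field_differentiable_derivI intro!: DERIV_add DERIV_cmult)
  qed fact
qed

text \<open>Bootstrapping: \<open>f\<close> itself occurs on the right-hand side, but each order of
  smoothness already gained for \<open>f\<close> makes \<open>k * (g - f)\<close> equally smooth, as
  long as \<open>g\<close> is, and this gives \<open>f\<close> one more order.\<close>

lemma Cn_on_Suc_linear_ode:
  assumes "open S" and der: "\<And>x. x \<in> S \<Longrightarrow> (f has_real_derivative k * (g x - f x)) (at x)"
    and "Cn_on n S g"
  shows "Cn_on (Suc n) S f"
  using assms(3)
proof (induction n)
  case 0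
  have "continuous_on S f"
    using der by (intro continuous_at_imp_continuous_on ballI DERIV_isCont) blast
  then show ?case
    using 0 by (intro Cn_on_SucI[OF \<open>open S\<close> der]) (auto simp: Cn_on_0 intro!: continuous_intros)
next
  case (Suc n)
  then have "Cn_on (Suc n) S f" by (simp add: Cn_on_SucD)
  then have "Cn_on (Suc n) S (\<lambda>x. k * g x + (- k) * f x)"
    using Suc.prems by (intro Cn_on_linear_combination \<open>open S\<close>)
  then show ?case
    by (intro Cn_on_SucI[OF \<open>open S\<close> der]) (auto simp: algebra_simps)
qed

text \<open>L'Hospital's rule for the difference quotient. It extends a differential equation known
  off one point to that point.\<close>

lemma has_real_derivative_limit:
  fixes f g :: "real \<Rightarrow> real"
  assumes "isCont f a" and der: "\<And>x. x \<noteq> a \<Longrightarrow> (f has_real_derivative g x) (at x)"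
    and lim: "(g \<longlongrightarrow> l) (at a)"
  shows "(f has_real_derivative l) (at a)"
  unfolding has_field_derivative_iff
proof (rule lhopital)
  show "((\<lambda>x. f x - f a) \<longlongrightarrow> 0) (at a)"
    using assms(1) by (simp add: isCont_def LIM_zero)
  show "((\<lambda>x. x - a) \<longlongrightarrow> 0) (at a)"
    by (intro LIM_zero tendsto_ident_at)
  show "\<forall>\<^sub>F x in at a. x - a \<noteq> 0"
    by (auto simp: eventually_at_filter)
  show "\<forall>\<^sub>F x in at a. ((\<lambda>x. f x - f a) has_real_derivative g x) (at x)"
    using der by (auto simp: eventually_at_filter intro!: always_eventually derivative_eq_intros)
  show "\<forall>\<^sub>F x in at a. ((\<lambda>x. x - a) has_real_derivative 1) (at x)"
    by (auto intro!: always_eventually derivative_eq_intros)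
qed (use lim in auto)

text \<open>The part of the claim that concerns the whole line, isolated as the induction invariant.
  The guard encodes the empty condition C^(-1): for \<open>n = 0\<close> the truncated
  \<open>n - 1\<close> would demand continuity.\<close>

definition sharp_Cn :: "nat \<Rightarrow> (real \<Rightarrow> real) \<Rightarrow> bool" where
  "sharp_Cn n f \<longleftrightarrow>
     (n \<ge> 1 \<longrightarrow> Cn_on (n - 1) UNIV f) \<and> \<not> Cn_on n UNIV f"

text \<open>\<open>f\<close> solves \<open>f' = k (g - f)\<close> away from the origin, so it is one order smoother than \<open>g\<close>;
  conversely \<open>g = f' / k + f\<close> there.\<close>

lemma sharp_Cn_Suc:
  fixes f g :: "real \<Rightarrow> real"
  assumes "k \<noteq> 0" and der: "\<And>x. x \<noteq> 0 \<Longrightarrow> (f has_real_derivative k * (g x - f x)) (at x)"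
    and cont: "isCont f 0" and g0: "\<And>l. (g \<longlongrightarrow> l) (at 0) \<Longrightarrow> g 0 = l"
    and g: "sharp_Cn n g"
  shows "sharp_Cn (Suc n) f"
proof -
  have "Cn_on n UNIV f"
  proof (cases n)
    \<comment> \<open>Here \<open>sharp_Cn n g\<close> gives no regularity of \<open>g\<close>;
      continuity of \<open>f\<close> at the origin comes from \<open>cont\<close>.\<close>
    case 0
    have "isCont f x" for x
      using cont DERIV_isCont[OF der] by (cases "x = 0") auto
    then show ?thesis
      using 0 by (auto simp: Cn_on_0 intro: continuous_at_imp_continuous_on)
  next
    case (Suc m)
    then have gm: "Cn_on m UNIV g" using g by (auto simp: sharp_Cn_def)
    then have "isCont g 0"
      using Cn_on_imp_continuous_on continuous_on_eq_continuous_at open_UNIV by blast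
    \<comment> \<open>Off the origin \<open>f'\<close> equals \<open>k * (g - f)\<close>, which has
      a limit at 0, so the differential equation holds at 0 too and bootstrapping applies on the
      whole line.\<close>
    then have "((\<lambda>x. k * (g x - f x)) \<longlongrightarrow> k * (g 0 - f 0)) (at 0)"
      using cont by (auto simp: isCont_def intro!: tendsto_intros)
    then have "(f has_real_derivative k * (g 0 - f 0)) (at 0)"
      using cont der by (rule has_real_derivative_limit[rotated 2])
    then have "(f has_real_derivative k * (g x - f x)) (at x)" for x
      using der by (cases "x = 0") auto
    then show ?thesis
      unfolding Suc using gm by (intro Cn_on_Suc_linear_ode[where g = g and k = k]) auto
  qed
  moreover have "\<not> Cn_on (Suc n) UNIV f"
  proof
    assume f: "Cn_on (Suc n) UNIV f"
    define h where "h = (\<lambda>x. (1 / k) * deriv f x + 1 * f x)"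
    have h: "Cn_on n UNIV h"
      unfolding h_def using f Cn_on_SucD[OF f]
      by (intro Cn_on_linear_combination) (auto simp: Cn_on_Suc)
    have hg: "h x = g x" if "x \<noteq> 0" for x
      using DERIV_imp_deriv[OF der[OF that]] \<open>k \<noteq> 0\<close> by (simp add: h_def)
    have "isCont h 0"
      using h Cn_on_imp_continuous_on continuous_on_eq_continuous_at open_UNIV by blast
    then have "(g \<longlongrightarrow> h 0) (at 0)"
      unfolding isCont_def
      by (rule Lim_transform_eventually) (auto simp: eventually_at_filter hg)
    \<comment> \<open>Off the origin this is \<open>hg\<close>; at the origin, \<open>g0\<close>
      forces \<open>g 0\<close> to be the limit \<open>h 0\<close>. Without this rule an ill-chosen
      value \<open>g 0\<close> could by itself destroy continuity of \<open>g\<close>.\<close>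
    then have "h = g"
      using g0 hg by (intro HOL.ext) metis
    then show False using h g by (simp add: sharp_Cn_def)
  qed
  ultimately show ?thesis by (simp add: sharp_Cn_def)
qed

section \<open>Differentiation under the integral\<close>

text \<open>The limit is tested along sequences, for each of which dominated convergence
  applies.\<close>

lemma tendsto_lebesgue_integral_at:
  fixes f :: "real \<Rightarrow> 'a \<Rightarrow> real"
  assumes "open S" "integrable M w" "g \<in> borel_measurable M"
    and meas: "\<And>t. t \<in> S \<Longrightarrow> f t \<in> borel_measurable M"
    and lim: "\<And>v. ((\<lambda>t. f t v) \<longlongrightarrow> g v) (at x within S)"
    and bnd: "\<And>t v. t \<in> S \<Longrightarrow> t \<noteq> x \<Longrightarrow> \<bar>f t v\<bar> \<le> w v"
  shows "((\<lambda>t. \<integral>v. f t v \<partial>M) \<longlongrightarrow> (\<integral>v. g v \<partial>M)) (at x within S)"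
  unfolding tendsto_at_iff_sequentially
proof (intro allI impI)
  fix X :: "nat \<Rightarrow> real"
  assume X: "\<forall>i. X i \<in> S - {x}" "X \<longlonglongrightarrow> x"
  have "(\<lambda>i. f (X i) v) \<longlonglongrightarrow> g v" for v
    using lim[of v] X unfolding tendsto_at_iff_sequentially comp_def by blast
  then show "((\<lambda>t. \<integral>v. f t v \<partial>M) \<circ> X) \<longlonglongrightarrow> (\<integral>v. g v \<partial>M)"
    unfolding comp_def using X assms
    by (intro integral_dominated_convergence[where w = w]) auto
qed

text \<open>By the mean value inequality, the bound \<open>w\<close> on the derivatives also bounds
  the difference quotients, so dominated convergence applies to them.\<close>

lemma has_real_derivative_lebesgue_integral:
  fixes f f' :: "real \<Rightarrow> 'a \<Rightarrow> real"
  assumes x: "a < x" "x < b" and w: "integrable M w" and f': "f' x \<in> borel_measurable M"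
    and int: "\<And>t. a < t \<Longrightarrow> t < b \<Longrightarrow> integrable M (f t)"
    and der: "\<And>t v. a < t \<Longrightarrow> t < b \<Longrightarrow> ((\<lambda>t. f t v) has_real_derivative f' t v) (at t)"
    and bnd: "\<And>t v. a < t \<Longrightarrow> t < b \<Longrightarrow> \<bar>f' t v\<bar> \<le> w v"
  shows "((\<lambda>t. \<integral>v. f t v \<partial>M) has_real_derivative (\<integral>v. f' x v \<partial>M)) (at x)"
proof -
  have at_x: "at x within {a<..<b} = at x"
    using x by (intro at_within_open) auto
  have "((\<lambda>t. \<integral>v. (f t v - f x v) / (t - x) \<partial>M) \<longlongrightarrow> (\<integral>v. f' x v \<partial>M)) (at x within {a<..<b})"
  proof (rule tendsto_lebesgue_integral_at[OF _ w f'])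
    show "(\<lambda>v. (f t v - f x v) / (t - x)) \<in> borel_measurable M" if "t \<in> {a<..<b}" for t
      using int[of t] int[OF x] that by auto
    show "((\<lambda>t. (f t v - f x v) / (t - x)) \<longlongrightarrow> f' x v) (at x within {a<..<b})" for v
      using der[OF x, of v] by (simp only: has_field_derivative_iff at_x)
    show "\<bar>(f t v - f x v) / (t - x)\<bar> \<le> w v" if "t \<in> {a<..<b}" "t \<noteq> x" for t v
    proof -
      have "norm (f t v - f x v) \<le> w v * norm (t - x)"
      proof (rule field_differentiable_bound[of "{a<..<b}" "\<lambda>t. f t v" "\<lambda>t. f' t v"])
        show "((\<lambda>t. f t v) has_real_derivative f' s v) (at s within {a<..<b})"
          if "s \<in> {a<..<b}" for s
          using that by (intro has_field_derivative_at_within[OF der]) auto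
        show "norm (f' s v) \<le> w v" if "s \<in> {a<..<b}" for s
          using that bnd by simp
      qed (use that x in auto)
      then show ?thesis
        using that by (simp add: abs_divide pos_divide_le_eq)
    qed
  qed simp
  moreover have "(\<integral>v. (f t v - f x v) / (t - x) \<partial>M) = ((\<integral>v. f t v \<partial>M) - (\<integral>v. f x v \<partial>M)) / (t - x)"
    if "t \<in> {a<..<b}" for t
    using int[of t] int[OF x] that by simp
  then have "\<forall>\<^sub>F t in at x within {a<..<b}. (\<integral>v. (f t v - f x v) / (t - x) \<partial>M) =
      ((\<integral>v. f t v \<partial>M) - (\<integral>v. f x v \<partial>M)) / (t - x)"
    unfolding eventually_at_filter by (intro always_eventually) auto
  ultimately have "((\<lambda>t. ((\<integral>v. f t v \<partial>M) - (\<integral>v. f x v \<partial>M)) / (t - x)) \<longlongrightarrow> (\<integral>v. f' x v \<partial>M))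
      (at x within {a<..<b})"
    by (rule Lim_transform_eventually)
  then show ?thesis
    by (simp only: has_field_derivative_iff at_x)
qed

section \<open>The integral in the density formula\<close>

text \<open>For \<open>x > 0\<close> the density has \<open>b = am\<close>, \<open>c = ap\<close>,
  \<open>L = lp + lm\<close>; for \<open>x < 0\<close> the two shapes swap. The exponent
  \<open>c\<close> may be any real, since differentiation in \<open>x\<close> lowers it by
  one.\<close>

definition bg_integrand :: "real \<Rightarrow> real \<Rightarrow> real \<Rightarrow> real \<Rightarrow> real \<Rightarrow> real" where
  "bg_integrand b c L x v = v powr (b - 1) * (x + v / L) powr (c - 1) * exp (- v)"

text \<open>For positive \<open>b\<close>, \<open>L\<close>, \<open>x\<close> this is
  \<open>L powr b * x powr (b + c - 1) * Gamma b * U(b, b + c, L * x)\<close> with Tricomi's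
  confluent hypergeometric function U.\<close>

definition bg_integral :: "real \<Rightarrow> real \<Rightarrow> real \<Rightarrow> real \<Rightarrow> real" where
  "bg_integral b c L x = (LBINT v:{0<..}. bg_integrand b c L x v)"

lemma bg_integrand_measurable [measurable]: "bg_integrand b c L x \<in> borel_measurable borel"
  unfolding bg_integrand_def [abs_def] by measurable

lemma bg_integrand_nonneg: "0 \<le> bg_integrand b c L x v"
  by (simp add: bg_integrand_def)

lemma bg_integrand_integrable:
  "\<lbrakk>b > 0; x > 0; L > 0\<rbrakk> \<Longrightarrow> set_integrable lborel {0<..} (bg_integrand b c L x)"
  unfolding bg_integrand_def [abs_def] by (rule bilateral_gamma_integrand_integrable)

text \<open>A power is monotone in its base, increasing or decreasing with the sign of the exponent;
  the sum of the endpoint values covers both cases. It provides majorants uniform in the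
  parameter.\<close>

lemma powr_le_add_endpoints:
  fixes s t u e :: real
  assumes "0 < s" "s \<le> t" "t \<le> u"
  shows "t powr e \<le> s powr e + u powr e"
proof (cases "e \<ge> 0")
  case True
  then have "t powr e \<le> u powr e" using assms by (intro powr_mono2) auto
  then show ?thesis by (simp add: add_increasing)
next
  case False
  then have "t powr e \<le> s powr e" using assms by (intro powr_mono2') auto
  then show ?thesis by (simp add: add_increasing2)
qed

lemma bg_integrand_le_add_endpoints:
  assumes "0 < s + v / L" "s \<le> t" "t \<le> u"
  shows "bg_integrand b c L t v \<le> bg_integrand b c L s v + bg_integrand b c L u v"
proof -
  have "(t + v / L) powr (c - 1) \<le> (s + v / L) powr (c - 1) + (u + v / L) powr (c - 1)"
    using assms by (intro powr_le_add_endpoints) auto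
  then have "v powr (b - 1) * exp (- v) * (t + v / L) powr (c - 1) \<le>
      v powr (b - 1) * exp (- v) * ((s + v / L) powr (c - 1) + (u + v / L) powr (c - 1))"
    by (intro mult_left_mono) auto
  then show ?thesis by (simp add: bg_integrand_def algebra_simps)
qed

lemma bg_integrand_has_derivative:
  assumes "0 < x" "0 < v" "0 < L"
  shows "((\<lambda>t. bg_integrand b c L t v) has_real_derivative (c - 1) * bg_integrand b (c - 1) L x v) (at x)"
proof -
  have "0 < x + v / L" using assms by (simp add: add_pos_pos)
  then show ?thesis unfolding bg_integrand_def
    by (auto intro!: derivative_eq_intros)
qed

lemma bg_integral_has_derivative:
  assumes "b > 0" "L > 0" "x > 0"
  shows "(bg_integral b c L has_real_derivative (c - 1) * bg_integral b (c - 1) L x) (at x)"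
proof -
  let ?S = "{0<..} :: real set"
  let ?f = "\<lambda>t v. indicator ?S v *\<^sub>R bg_integrand b c L t v"
  let ?f' = "\<lambda>t v. (c - 1) * (indicator ?S v *\<^sub>R bg_integrand b (c - 1) L t v)"
  \<comment> \<open>On the window from \<open>x / 2\<close> to \<open>2 * x\<close> the base stays
    away from 0, and the integrands at its two ends dominate all those between.\<close>
  let ?w = "\<lambda>v. \<bar>c - 1\<bar> * (indicator ?S v *\<^sub>R bg_integrand b (c - 1) L (x / 2) v +
      indicator ?S v *\<^sub>R bg_integrand b (c - 1) L (2 * x) v)"
  have "((\<lambda>t. \<integral>v. ?f t v \<partial>lborel) has_real_derivative (\<integral>v. ?f' x v \<partial>lborel)) (at x)"
  proof (rule has_real_derivative_lebesgue_integral[of "x / 2" _ "2 * x" _ ?w])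
    show "integrable lborel ?w"
      using bg_integrand_integrable assms unfolding set_integrable_def
      by (intro integrable_mult_right Bochner_Integration.integrable_add) auto
    show "integrable lborel (?f t)" if "x / 2 < t" for t
      using bg_integrand_integrable[of b t L c] assms that unfolding set_integrable_def by auto
    show "((\<lambda>t. ?f t v) has_real_derivative ?f' t v) (at t)" if "x / 2 < t" for t v
      using bg_integrand_has_derivative[of t v L b c] that assms by (cases "0 < v") auto
    show "\<bar>?f' t v\<bar> \<le> ?w v" if "x / 2 < t" "t < 2 * x" for t v
    proof (cases "0 < v")
      case True
      have "bg_integrand b (c - 1) L t v \<le> bg_integrand b (c - 1) L (x / 2) v + bg_integrand b (c - 1) L (2 * x) v"
        using True assms that by (intro bg_integrand_le_add_endpoints add_pos_pos) auto
      then show ?thesis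
        using True by (simp add: abs_mult bg_integrand_nonneg mult_left_mono)
    qed auto
  qed (use assms in auto)
  then show ?thesis
    by (simp add: bg_integral_def [abs_def] set_lebesgue_integral_def)
qed

text \<open>Differentiation in \<open>x\<close> only lowers the exponent of
  \<open>x + v / L\<close>. On the negative half-line the shape to be lowered sits on
  \<open>v\<close> instead, and this identity trades one for the other.\<close>

lemma bg_integral_by_parts:
  assumes "a > 1" "L > 0" "y > 0"
  shows "bg_integral a b L y =
    (a - 1) * bg_integral (a - 1) b L y + (b - 1) / L * bg_integral a (b - 1) L y"
proof -
  let ?F = "bg_integrand a b L y"
  let ?F' = "\<lambda>v. (a - 1) * bg_integrand (a - 1) b L y v + (b - 1) / L * bg_integrand a (b - 1) L y v - ?F v"
  have int: "set_integrable lborel {0<..} (bg_integrand a b L y)"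
    "set_integrable lborel {0<..} (bg_integrand (a - 1) b L y)"
    "set_integrable lborel {0<..} (bg_integrand a (b - 1) L y)"
    using assms by (auto intro: bg_integrand_integrable)
  have pos: "0 < y + v / L" if "0 < v" for v
    using assms that by (simp add: add_pos_pos)
  \<comment> \<open>Both boundary values vanish: at 0 because \<open>a > 1\<close> makes
    \<open>v powr (a - 1)\<close> tend to 0, at infinity because of
    \<open>exp (- v)\<close>.\<close>
  have "(LBINT v=ereal 0..\<infinity>. ?F' v) = 0 - 0"
  proof (rule interval_integral_FTC_integrable[where F = ?F])
    show "(?F has_vector_derivative ?F' v) (at v)" if "ereal 0 < ereal v" for v
    proof -
      from that have v: "0 < v" by simp
      show ?thesis
        unfolding has_real_derivative_iff_has_vector_derivative [symmetric] bg_integrand_def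
        using v pos[OF v] \<open>L > 0\<close>
        by (auto intro!: derivative_eq_intros simp: field_simps)
    qed
    show "isCont ?F' v" if "ereal 0 < ereal v" for v
      using that pos[of v] \<open>L > 0\<close> unfolding bg_integrand_def
      by (auto intro!: continuous_intros)
    show "set_integrable lborel (einterval (ereal 0) \<infinity>) ?F'"
      unfolding einterval_eq using int
      by (intro set_integral_add set_integral_diff set_integrable_mult_right)
    have "((\<lambda>v. v powr (a - 1) * (y + v / L) powr (b - 1) * exp (- v)) \<longlongrightarrow>
        0 * (y + 0 / L) powr (b - 1) * exp (- 0)) (at_right 0)"
      using assms
      by (intro tendsto_intros tendsto_zero_powrI[where b = "a - 1"]) (auto simp: eventually_at_filter)
    then show "((?F \<circ> real_of_ereal) \<longlongrightarrow> 0) (at_right (ereal 0))"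
      unfolding ereal_tendsto_simps bg_integrand_def [abs_def] by simp
    have "((\<lambda>v. v powr (a - 1) * (y + v / L) powr (b - 1) * exp (- v)) \<longlongrightarrow> 0) at_top"
      using assms by real_asymp
    then show "((?F \<circ> real_of_ereal) \<longlongrightarrow> 0) (at_left \<infinity>)"
      unfolding ereal_tendsto_simps bg_integrand_def [abs_def] .
  qed simp
  then have "(LBINT v:{0<..}. ?F' v) = 0"
    by (simp add: interval_integral_to_infinity_eq)
  also have "(LBINT v:{0<..}. ?F' v) =
      (a - 1) * bg_integral (a - 1) b L y + (b - 1) / L * bg_integral a (b - 1) L y - bg_integral a b L y"
    using int unfolding bg_integral_def
    by (simp add: set_integral_add set_integral_diff)
  finally show ?thesis by simp
qed

section \<open>The integral at and near the origin\<close>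

lemma bg_integrand_0:
  assumes "0 < L" "0 < v"
  shows "bg_integrand b c L 0 v = L powr (1 - c) * (v powr (b + c - 1 - 1) * exp (- v))"
proof -
  have "v powr (b + c - 1 - 1) = v powr (b - 1) * v powr (c - 1)"
    by (simp add: powr_add [symmetric] algebra_simps)
  moreover have "(v / L) powr (c - 1) = v powr (c - 1) * L powr (1 - c)"
    using assms by (simp add: powr_divide powr_minus_divide [symmetric] divide_powr_uminus)
  ultimately show ?thesis by (simp add: bg_integrand_def)
qed

text \<open>At \<open>x = 0\<close> the two powers merge into one of exponent
  \<open>b + c - 2\<close>, a Gamma integrand. This is the source of the threshold 1 for the sum of
  the shapes.\<close>

lemma bg_integrand_0_integrable:
  assumes "0 < L" "1 < b + c"
  shows "set_integrable lborel {0<..} (bg_integrand b c L 0)"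
proof -
  have "set_integrable lborel {0<..} (\<lambda>v. L powr (1 - c) * (v powr (b + c - 1 - 1) * exp (- v)))"
    using assms by (intro set_integrable_mult_right Gamma_integrand_integrable) auto
  then show ?thesis
    using assms by (subst set_integrable_cong[OF refl refl bg_integrand_0]) auto
qed

lemma bg_integral_0:
  assumes "0 < L" "1 < b + c"
  shows "bg_integral b c L 0 = L powr (1 - c) * Gamma (b + c - 1)"
proof -
  let ?h = "\<lambda>v. v powr (b + c - 1 - 1) * exp (- v)"
  have "(LBINT v:{0<..}. ?h v) = integral {0<..} ?h"
    using assms by (intro set_borel_integral_eq_integral Gamma_integrand_integrable) auto
  also have "\<dots> = integral {0..} ?h"
    by (intro integral_subset_negligible) (auto intro: negligible_subset[of "{0}"])
  also have "\<dots> = Gamma (b + c - 1)"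
    using Gamma_integral_real[of "b + c - 1"] assms
    by (intro integral_unique) (auto simp: exp_minus field_simps)
  finally have "Gamma (b + c - 1) = (LBINT v:{0<..}. ?h v)" ..
  moreover have "bg_integral b c L 0 = (LBINT v:{0<..}. L powr (1 - c) * ?h v)"
    unfolding bg_integral_def using assms
    by (intro set_lebesgue_integral_cong) (auto simp: bg_integrand_0)
  ultimately show ?thesis by simp
qed

lemma bg_integral_tendsto_0:
  assumes "b > 0" "L > 0" "1 < b + c"
  shows "(bg_integral b c L \<longlongrightarrow> bg_integral b c L 0) (at_right 0)"
proof -
  let ?S = "{0<..} :: real set"
  let ?f = "\<lambda>t v. indicator ?S v *\<^sub>R bg_integrand b c L t v"
  have "((\<lambda>t. \<integral>v. ?f t v \<partial>lborel) \<longlongrightarrow> (\<integral>v. ?f 0 v \<partial>lborel)) (at 0 within {0<..<1})"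
  \<comment> \<open>The integrands at the ends 0 and 1 dominate those between; the one at 0 is
    integrable because \<open>1 < b + c\<close>.\<close>
  proof (rule tendsto_lebesgue_integral_at[where w = "\<lambda>v. ?f 0 v + ?f 1 v"])
    show "integrable lborel (\<lambda>v. ?f 0 v + ?f 1 v)"
      using bg_integrand_integrable[of b 1 L c] bg_integrand_0_integrable[of L b c] assms
      unfolding set_integrable_def by (intro Bochner_Integration.integrable_add) auto
    show "((\<lambda>t. ?f t v) \<longlongrightarrow> ?f 0 v) (at 0 within {0<..<1})" for v
      using assms by (cases "0 < v") (auto simp: bg_integrand_def intro!: tendsto_eq_intros)
    show "\<bar>?f t v\<bar> \<le> ?f 0 v + ?f 1 v" if "t \<in> {0<..<1}" for t v
      using bg_integrand_le_add_endpoints[of 0 v L t 1 b c] that assms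
      by (cases "0 < v") (auto simp: bg_integrand_nonneg)
  qed auto
  moreover have "at 0 within {0<..<1} = at_right (0 :: real)"
    by (rule at_within_nhd[of _ "{..<1}"]) auto
  ultimately show ?thesis
    by (simp add: bg_integral_def [abs_def] set_lebesgue_integral_def)
qed

lemma bg_integral_antimono_0:
  assumes "b > 0" "L > 0" "x > 0" "c \<le> 1" "1 < b + c"
  shows "bg_integral b c L x \<le> bg_integral b c L 0"
  unfolding bg_integral_def
proof (rule set_integral_mono)
  show "bg_integrand b c L x v \<le> bg_integrand b c L 0 v" if "v \<in> {0<..}" for v
    unfolding bg_integrand_def using assms that
    by (intro mult_right_mono mult_left_mono powr_mono2') auto
qed (use assms in \<open>auto intro: bg_integrand_integrable bg_integrand_0_integrable\<close>)

text \<open>Only \<open>v\<close> in \<open>[x, 1]\<close> is kept. There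
  \<open>x + v / L <= (1 + 1 / L) * v\<close>, and \<open>c < 1\<close> reverses this for the
  powers. What remains is a constant times \<open>v powr (b + c - 2)\<close>, which is at least
  \<open>1 / v\<close> since \<open>v <= 1\<close> and \<open>b + c <= 1\<close>; and
  \<open>1 / v\<close> integrates to \<open>- ln x\<close>.\<close>

lemma bg_integral_ge_ln:
  assumes "b > 0" "L > 0" "c > 0" "b + c \<le> 1" "0 < x" "x < 1"
  shows "(1 + 1 / L) powr (c - 1) * exp (- 1) * - ln x \<le> bg_integral b c L x"
proof -
  let ?C = "(1 + 1 / L) powr (c - 1) * exp (- 1)"
  have hb: "has_bochner_integral lborel (\<lambda>v. ?C * (1 / v) * indicator {x..1} v) (?C * ln 1 - ?C * ln x)"
    using assms
    by (intro has_bochner_integral_FTC_Icc_real)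
       (auto intro!: derivative_eq_intros continuous_intros)
  have "?C * - ln x = (\<integral>v. ?C * (1 / v) * indicator {x..1} v \<partial>lborel)"
    using has_bochner_integral_integral_eq[OF hb] by simp
  also have "\<dots> \<le> (\<integral>v. indicator {0<..} v *\<^sub>R bg_integrand b c L x v \<partial>lborel)"
  proof (rule integral_mono)
    show "integrable lborel (\<lambda>v. ?C * (1 / v) * indicator {x..1} v)"
      using hb by (rule integrable.intros)
    show "integrable lborel (\<lambda>v. indicator {0<..} v *\<^sub>R bg_integrand b c L x v)"
      using bg_integrand_integrable[of b x L c] assms by (simp add: set_integrable_def)
    show "?C * (1 / v) * indicator {x..1} v \<le> indicator {0<..} v *\<^sub>R bg_integrand b c L x v" for v
    proof (cases "v \<in> {x..1}")
      case True
      then have v: "0 < v" "x \<le> v" "v \<le> 1" using assms by auto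
      have "1 / v = v powr - 1" using v by (simp add: powr_minus_divide)
      also have "\<dots> \<le> v powr (b + c - 2)" using v assms by (intro powr_mono') auto
      also have "\<dots> = v powr (b - 1) * v powr (c - 1)"
        by (simp add: powr_add [symmetric] algebra_simps)
      finally have 1: "1 / v \<le> v powr (b - 1) * v powr (c - 1)" .
      have "((1 + 1 / L) * v) powr (c - 1) \<le> (x + v / L) powr (c - 1)"
        using v assms by (intro powr_mono2') (auto simp: algebra_simps add_pos_pos)
      then have 2: "(1 + 1 / L) powr (c - 1) * v powr (c - 1) \<le> (x + v / L) powr (c - 1)"
        using v assms by (simp add: powr_mult)
      have "?C * (1 / v) \<le> ?C * (v powr (b - 1) * v powr (c - 1))"
        using 1 by (intro mult_left_mono) auto
      also have "\<dots> = v powr (b - 1) * ((1 + 1 / L) powr (c - 1) * v powr (c - 1)) * exp (- 1)"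
        by simp
      also have "\<dots> \<le> v powr (b - 1) * (x + v / L) powr (c - 1) * exp (- v)"
        using 2 v by (intro mult_mono) auto
      finally show ?thesis using True v by (simp add: bg_integrand_def)
    qed (auto simp: bg_integrand_nonneg indicator_def)
  qed
  finally show ?thesis by (simp add: bg_integral_def set_lebesgue_integral_def)
qed

section \<open>Regularity of the density\<close>

lemma bilateral_gamma_formula_eq:
  "bilateral_gamma_formula a lp b lm = (\<lambda>x. lp powr a * lm powr b /
     ((lp + lm) powr b * Gamma a * Gamma b) * exp (- lp * x) * bg_integral b a (lp + lm) x)"
  by (simp add: fun_eq_iff bilateral_gamma_formula_def bg_integral_def bg_integrand_def)

text \<open>Bookkeeping for the next two derivatives: \<open>K\<close> and \<open>M\<close> are the
  normalising constants for the shapes \<open>a\<close> and \<open>a - 1\<close>, \<open>l\<close>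
  is the rate, \<open>e\<close> the exponential factor, and \<open>d\<close> the factor
  \<open>a - 1\<close> or \<open>(lp + lm) * (a - 1)\<close>.\<close>

lemma scaled_difference_eq:
  fixes K :: real
  assumes "K * d = l * M"
  shows "K * e * (d * B - l * A) = l * (M * e * B - K * e * A)"
    and "K * e * (l * A - d * B) = l * (K * e * A - M * e * B)"
  using assms by algebra+

lemma Gamma_minus_1:
  fixes a :: real
  assumes "a > 1"
  shows "Gamma a = (a - 1) * Gamma (a - 1)"
  using Gamma_plus1[of "a - 1"] assms by (force elim: nonpos_Ints_cases')

text \<open>The exponential contributes the term in \<open>a\<close>, the integral the term in
  \<open>a - 1\<close>; the constants match by \<open>Gamma a = (a - 1) * Gamma (a - 1)\<close> and
  \<open>lp powr a = lp * lp powr (a - 1)\<close>.\<close>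

lemma bilateral_gamma_formula_has_derivative_fst:
  assumes "a > 1" "b > 0" "lp > 0" "lm > 0" "x > 0"
  shows "(bilateral_gamma_formula a lp b lm has_real_derivative
    lp * (bilateral_gamma_formula (a - 1) lp b lm x - bilateral_gamma_formula a lp b lm x)) (at x)"
proof -
  let ?L = "lp + lm"
  define K where "K = lp powr a * lm powr b / (?L powr b * Gamma a * Gamma b)"
  have pos: "Gamma (a - 1) > 0" "Gamma b > 0" using assms by (auto intro: Gamma_real_pos)
  have "((\<lambda>x. K * exp (- lp * x) * bg_integral b a ?L x) has_real_derivative
      K * exp (- lp * x) * ((a - 1) * bg_integral b (a - 1) ?L x - lp * bg_integral b a ?L x)) (at x)"
    using assms by (auto intro!: derivative_eq_intros bg_integral_has_derivative simp: algebra_simps)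
  moreover have "lp powr a = lp * lp powr (a - 1)"
    using assms by (simp add: powr_diff)
  then have "K * (a - 1) = lp * (lp powr (a - 1) * lm powr b / (?L powr b * Gamma (a - 1) * Gamma b))"
    using assms pos by (simp add: K_def Gamma_minus_1[of a] divide_simps mult_ac)
  then have "K * exp (- lp * x) * ((a - 1) * bg_integral b (a - 1) ?L x - lp * bg_integral b a ?L x) =
      lp * (lp powr (a - 1) * lm powr b / (?L powr b * Gamma (a - 1) * Gamma b) * exp (- lp * x) *
        bg_integral b (a - 1) ?L x - K * exp (- lp * x) * bg_integral b a ?L x)"
    by (rule scaled_difference_eq)
  ultimately show ?thesis
    by (simp add: bilateral_gamma_formula_eq K_def)
qed

text \<open>Serves the negative half-line, where the formula is evaluated at \<open>- x\<close>;
  hence the opposite sign.\<close>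

lemma bilateral_gamma_formula_has_derivative_snd:
  assumes "a > 1" "b > 0" "lp > 0" "lm > 0" "x > 0"
  shows "(bilateral_gamma_formula b lm a lp has_real_derivative
    lp * (bilateral_gamma_formula b lm a lp x - bilateral_gamma_formula b lm (a - 1) lp x)) (at x)"
proof -
  let ?L = "lm + lp"
  define K where "K = lm powr b * lp powr a / (?L powr a * Gamma b * Gamma a)"
  let ?M = "lm powr b * lp powr (a - 1) / (?L powr (a - 1) * Gamma b * Gamma (a - 1))"
  have pos: "Gamma (a - 1) > 0" "Gamma b > 0" "?L > 0"
    using assms by (auto intro: Gamma_real_pos)
  have "((\<lambda>x. K * exp (- lm * x) * bg_integral a b ?L x) has_real_derivative
      K * exp (- lm * x) * ((b - 1) * bg_integral a (b - 1) ?L x - lm * bg_integral a b ?L x)) (at x)"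
    using assms by (auto intro!: derivative_eq_intros bg_integral_has_derivative simp: algebra_simps)
  moreover have "(b - 1) * bg_integral a (b - 1) ?L x =
      ?L * bg_integral a b ?L x - ?L * (a - 1) * bg_integral (a - 1) b ?L x"
    using bg_integral_by_parts[of a ?L x b] assms pos by (simp add: field_simps)
  \<comment> \<open>The coefficient \<open>?L = lm + lp\<close> from integration by parts and
    \<open>- lm\<close> from the exponential leave \<open>lp\<close>, the same rate as on the
    positive half-line.\<close>
  then have "(b - 1) * bg_integral a (b - 1) ?L x - lm * bg_integral a b ?L x =
      lp * bg_integral a b ?L x - ?L * (a - 1) * bg_integral (a - 1) b ?L x"
    by (simp add: algebra_simps)
  moreover have "lp powr a = lp * lp powr (a - 1)" "?L powr a = ?L * ?L powr (a - 1)"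
    using assms by (simp_all add: powr_diff)
  then have "K * (?L * (a - 1)) = lp * ?M"
    using assms pos by (simp add: K_def Gamma_minus_1[of a] divide_simps mult_ac)
  then have "K * exp (- lm * x) * (lp * bg_integral a b ?L x - ?L * (a - 1) * bg_integral (a - 1) b ?L x) =
      lp * (K * exp (- lm * x) * bg_integral a b ?L x - ?M * exp (- lm * x) * bg_integral (a - 1) b ?L x)"
    by (rule scaled_difference_eq)
  ultimately show ?thesis
    by (simp add: bilateral_gamma_formula_eq K_def)
qed

text \<open>Passing from X - Y to Y - X exchanges the two Gamma components. This carries results on
  the right half-line to the left, and results on the first shape to the second.\<close>

lemma is_bilateral_gamma_density_reflect:
  assumes "is_bilateral_gamma_density a lp b lm f"
  shows "is_bilateral_gamma_density b lm a lp (\<lambda>x. f (- x))"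
  unfolding is_bilateral_gamma_density_def
proof (intro conjI allI impI)
  fix l assume lim: "((\<lambda>x. f (- x)) \<longlongrightarrow> l) (at 0)"
  have "filterlim uminus (at 0) (at (0 :: real))"
    by (intro filterlim_atI tendsto_eq_intros) (auto simp: eventually_at_filter)
  from filterlim_compose[OF lim this] have "(f \<longlongrightarrow> l) (at 0)" by simp
  then show "f (- 0) = l" using assms by (simp add: is_bilateral_gamma_density_def)
qed (use assms in \<open>auto simp: is_bilateral_gamma_density_def\<close>)

lemma is_bilateral_gamma_density_exists: "\<exists>f. is_bilateral_gamma_density a lp b lm f"
proof -
  let ?g = "\<lambda>c x. if x > 0 then bilateral_gamma_formula a lp b lm x
    else if x < 0 then bilateral_gamma_formula b lm a lp (- x) else c"
  have "(?g c \<longlongrightarrow> l) (at 0) \<longleftrightarrow> (?g d \<longlongrightarrow> l) (at 0)" for c d l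
    by (intro filterlim_cong refl) (auto simp: eventually_at_filter)
  \<comment> \<open>A limit at 0 ignores the value at 0, so \<open>Lim\<close> may be computed from
    \<open>?g 0\<close>. If no limit exists, the condition on the chosen value is vacuous.\<close>
  then have "is_bilateral_gamma_density a lp b lm (?g (Lim (at 0) (?g 0)))"
    unfolding is_bilateral_gamma_density_def using tendsto_Lim[of "at 0" "?g 0"] by auto
  then show ?thesis by blast
qed

lemma bilateral_gamma_density_has_derivative:
  assumes f: "is_bilateral_gamma_density a lp b lm f"
    and g: "is_bilateral_gamma_density (a - 1) lp b lm g"
    and pos: "a > 1" "b > 0" "lp > 0" "lm > 0" and "x \<noteq> 0"
  shows "(f has_real_derivative lp * (g x - f x)) (at x)"
proof (cases "x > 0")
  case True
  have "(bilateral_gamma_formula a lp b lm has_real_derivative lp * (g x - f x)) (at x)"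
    using bilateral_gamma_formula_has_derivative_fst[OF pos True] True f g
    by (simp add: is_bilateral_gamma_density_def)
  then show ?thesis
    by (rule has_field_derivative_transform_within_open[of _ _ _ "{0<..}"])
       (use True f in \<open>auto simp: is_bilateral_gamma_density_def\<close>)
next
  case False
  then have x: "- x > 0" "x < 0" using \<open>x \<noteq> 0\<close> by auto
  have "(bilateral_gamma_formula b lm a lp has_real_derivative - (lp * (g x - f x))) (at (- x))"
    using bilateral_gamma_formula_has_derivative_snd[OF pos x(1)] x f g
    by (simp add: is_bilateral_gamma_density_def algebra_simps)
  then have "((\<lambda>x. bilateral_gamma_formula b lm a lp (- x)) has_real_derivative lp * (g x - f x)) (at x)"
    unfolding DERIV_mirror by simp
  then show ?thesis
    by (rule has_field_derivative_transform_within_open[of _ _ _ "{..<0}"])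
       (use x f in \<open>auto simp: is_bilateral_gamma_density_def\<close>)
qed

section \<open>Behaviour of the density at the origin\<close>

definition bilateral_gamma_value_0 :: "real \<Rightarrow> real \<Rightarrow> real \<Rightarrow> real \<Rightarrow> real" where
  "bilateral_gamma_value_0 a lp b lm =
     lp powr a * lm powr b * (lp + lm) powr (1 - a - b) * Gamma (a + b - 1) / (Gamma a * Gamma b)"

text \<open>By this symmetry the limits of the density from the left and from the right
  coincide.\<close>

lemma bilateral_gamma_value_0_commute:
  "bilateral_gamma_value_0 b lm a lp = bilateral_gamma_value_0 a lp b lm"
  by (simp add: bilateral_gamma_value_0_def algebra_simps)

lemma bilateral_gamma_value_0_eq:
  assumes "lp > 0" "lm > 0" "a + b > 1"
  shows "bilateral_gamma_value_0 a lp b lm = lp powr a * lm powr b /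
     ((lp + lm) powr b * Gamma a * Gamma b) * bg_integral b a (lp + lm) 0"
proof -
  have "(lp + lm) powr (1 - a - b) = (lp + lm) powr (1 - a) / (lp + lm) powr b"
    by (simp add: powr_diff)
  then show ?thesis
    using assms by (simp add: bg_integral_0 bilateral_gamma_value_0_def add_ac)
qed

lemma bilateral_gamma_formula_tendsto_0:
  assumes "a > 0" "b > 0" "lp > 0" "lm > 0" "a + b > 1"
  shows "(bilateral_gamma_formula a lp b lm \<longlongrightarrow> bilateral_gamma_value_0 a lp b lm) (at_right 0)"
proof -
  have "((\<lambda>x. lp powr a * lm powr b / ((lp + lm) powr b * Gamma a * Gamma b) * exp (- lp * x) *
      bg_integral b a (lp + lm) x) \<longlongrightarrow> lp powr a * lm powr b / ((lp + lm) powr b * Gamma a * Gamma b) *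
      exp (- lp * 0) * bg_integral b a (lp + lm) 0) (at_right 0)"
    using assms by (intro tendsto_mult tendsto_const tendsto_exp tendsto_ident_at bg_integral_tendsto_0) auto
  then show ?thesis
    using assms by (simp add: bilateral_gamma_formula_eq bilateral_gamma_value_0_eq)
qed

lemma bilateral_gamma_density_tendsto_0:
  assumes f: "is_bilateral_gamma_density a lp b lm f"
    and pos: "a > 0" "b > 0" "lp > 0" "lm > 0" "a + b > 1"
  shows "(f \<longlongrightarrow> bilateral_gamma_value_0 a lp b lm) (at 0)"
proof -
  have right: "(f \<longlongrightarrow> bilateral_gamma_value_0 a lp b lm) (at_right 0)"
    if "is_bilateral_gamma_density a lp b lm f" "a > 0" "b > 0" "lp > 0" "lm > 0" "a + b > 1"
    for f a b lp lm
    using bilateral_gamma_formula_tendsto_0[OF that(2-)]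
    by (rule Lim_transform_eventually)
       (use that(1) in \<open>auto simp: is_bilateral_gamma_density_def eventually_at_right_less
          intro: eventually_at_rightI[of 0 1]\<close>)
  have "((\<lambda>x. f (- x)) \<longlongrightarrow> bilateral_gamma_value_0 b lm a lp) (at_right 0)"
    by (intro right is_bilateral_gamma_density_reflect) (use f pos in auto)
  then have "(f \<longlongrightarrow> bilateral_gamma_value_0 a lp b lm) (at_left 0)"
    by (simp add: filterlim_at_left_to_right bilateral_gamma_value_0_commute)
  then show ?thesis
    using right[OF f pos] by (rule filterlim_split_at)
qed

lemma bilateral_gamma_density_0:
  assumes f: "is_bilateral_gamma_density a lp b lm f"
    and pos: "a > 0" "b > 0" "lp > 0" "lm > 0" "a + b > 1"
  shows "f 0 = bilateral_gamma_value_0 a lp b lm"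
  using bilateral_gamma_density_tendsto_0[OF assms] f by (simp add: is_bilateral_gamma_density_def)

lemma bilateral_gamma_density_isCont_0:
  assumes f: "is_bilateral_gamma_density a lp b lm f"
    and pos: "a > 0" "b > 0" "lp > 0" "lm > 0" "a + b > 1"
  shows "isCont f 0"
  using bilateral_gamma_density_tendsto_0[OF assms] bilateral_gamma_density_0[OF assms]
  by (simp add: isCont_def)

text \<open>\<open>e\<^bsup>lp x\<^esup> f(x)\<close> is maximal over \<open>[0, \<infinity>)\<close> at the origin, where its derivative is \<open>D + lp f(0)\<close>.\<close>

lemma bilateral_gamma_density_deriv_0_neg:
  assumes f: "is_bilateral_gamma_density a lp b lm f"
    and pos: "a > 0" "b > 0" "lp > 0" "lm > 0" "a + b > 1" and "a \<le> 1"
    and D: "(f has_real_derivative D) (at 0)"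
  shows "D < 0"
proof (rule ccontr)
  assume "\<not> D < 0"
  have f0: "f 0 > 0"
    using bilateral_gamma_density_0[OF f pos] pos
    by (simp add: bilateral_gamma_value_0_def Gamma_real_pos)
  have "((\<lambda>x. exp (lp * x) * f x) has_real_derivative D + lp * f 0) (at 0)"
    using D by (auto intro!: derivative_eq_intros)
  \<comment> \<open>A positive derivative would push \<open>exp (lp * x) * f x\<close> above
    \<open>f 0\<close> just to the right of 0, but there it is a constant multiple of an integral
    that is largest at 0 because \<open>a <= 1\<close>.\<close>
  moreover have "0 < D + lp * f 0"
    using \<open>\<not> D < 0\<close> f0 pos by (simp add: add_nonneg_pos)
  ultimately obtain d where d: "d > 0" "\<And>h. 0 < h \<Longrightarrow> h < d \<Longrightarrow> f 0 < exp (lp * h) * f h"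
    using DERIV_pos_inc_right[of "\<lambda>x. exp (lp * x) * f x" "D + lp * f 0" 0] by force
  let ?h = "d / 2" and ?K = "lp powr a * lm powr b / ((lp + lm) powr b * Gamma a * Gamma b)"
  have "exp (lp * ?h) * f ?h = ?K * bg_integral b a (lp + lm) ?h"
    using f \<open>d > 0\<close>
    by (simp add: is_bilateral_gamma_density_def bilateral_gamma_formula_eq exp_minus)
  also have "\<dots> \<le> ?K * bg_integral b a (lp + lm) 0"
    using pos \<open>a \<le> 1\<close> \<open>d > 0\<close> by (intro mult_left_mono bg_integral_antimono_0) (auto simp: Gamma_real_pos less_imp_le)
  also have "\<dots> = f 0"
    using bilateral_gamma_value_0_eq[of lp lm a b] bilateral_gamma_density_0[OF f pos] pos by simp
  finally show False using d(2)[of ?h] \<open>d > 0\<close> by simp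
qed

lemma bilateral_gamma_density_not_differentiable_0:
  assumes f: "is_bilateral_gamma_density a lp b lm f"
    and pos: "a > 0" "b > 0" "lp > 0" "lm > 0" "a + b > 1" and "a \<le> 1" "b \<le> 1"
  shows "\<not> f field_differentiable (at 0)"
proof
  assume "f field_differentiable (at 0)"
  \<comment> \<open>The point is written \<open>- 0\<close> so that \<open>DERIV_mirror\<close>
    matches.\<close>
  then obtain D where D: "(f has_real_derivative D) (at (- 0))"
    by (auto simp: field_differentiable_def)
  then have "D < 0"
    using bilateral_gamma_density_deriv_0_neg[OF f pos] \<open>a \<le> 1\<close> by simp
  moreover from D have "((\<lambda>x. f (- x)) has_real_derivative - D) (at 0)"
    by (simp only: DERIV_mirror)
  then have "- D < 0"
    using bilateral_gamma_density_deriv_0_neg[OF is_bilateral_gamma_density_reflect[OF f], of "- D"]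
      pos \<open>b \<le> 1\<close>
    by (simp add: add.commute)
  ultimately show False by simp
qed

lemma bilateral_gamma_density_not_isCont_0:
  assumes f: "is_bilateral_gamma_density a lp b lm f"
    and pos: "a > 0" "b > 0" "lp > 0" "lm > 0" and "a + b \<le> 1"
  shows "\<not> isCont f 0"
proof
  assume "isCont f 0"
  then have lim: "(f \<longlongrightarrow> f 0) (at_right 0)"
    by (simp add: isCont_def filterlim_at_split)
  let ?L = "lp + lm"
  \<comment> \<open>The factor \<open>exp (- lp)\<close> bounds \<open>exp (- lp * x)\<close> from
    below for \<open>0 < x < 1\<close>, so \<open>K\<close> is independent of
    \<open>x\<close>.\<close>
  define K where "K = lp powr a * lm powr b / (?L powr b * Gamma a * Gamma b) * exp (- lp)"
  define C where "C = (1 + 1 / ?L) powr (a - 1) * exp (- 1)"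
  have K: "K > 0" using pos by (simp add: K_def Gamma_real_pos)
  have "1 + 1 / ?L > 0" using pos by (simp add: add_pos_pos)
  then have C: "C > 0" by (simp add: C_def)
  have "K * (C * - ln x) \<le> f x" if x: "0 < x" "x < 1" for x
  proof -
    have "K * (C * - ln x) \<le> K * bg_integral b a ?L x"
      unfolding C_def using K x pos \<open>a + b \<le> 1\<close>
      by (intro mult_left_mono bg_integral_ge_ln) auto
    also have "\<dots> \<le> lp powr a * lm powr b / (?L powr b * Gamma a * Gamma b) * exp (- lp * x) *
        bg_integral b a ?L x"
      unfolding K_def using x pos
      by (intro mult_right_mono mult_left_mono)
         (auto simp: Gamma_real_pos less_imp_le bg_integral_def set_lebesgue_integral_def
            bg_integrand_nonneg intro!: integral_nonneg_AE)
    also have "\<dots> = f x"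
      using f x by (simp add: is_bilateral_gamma_density_def bilateral_gamma_formula_eq)
    finally show ?thesis .
  qed
  then have ev: "\<forall>\<^sub>F x in at_right 0. K * (C * - ln x) \<le> f x"
    by (intro eventually_at_rightI[of 0 1]) auto
  have "filterlim (\<lambda>x. K * (C * - ln x)) at_top (at_right 0)"
    using K C by real_asymp
  then have "filterlim f at_top (at_right 0)"
    using ev by (rule filterlim_at_top_mono)
  then have "filterlim f at_infinity (at_right 0)"
    by (rule filterlim_at_top_imp_at_infinity)
  with lim show False
    by (intro not_tendsto_and_filterlim_at_infinity[of "at_right (0 :: real)" f "f 0"]) auto
qed

section \<open>Smoothness away from the origin\<close>

lemma Cn_on_bg_integral:
  assumes "b > 0" "L > 0" and s: "s * s = 1"
  shows "Cn_on n {x. s * x > 0} (\<lambda>x. exp (- l * (s * x)) * bg_integral b c L (s * x))"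
proof -
  let ?h = "\<lambda>c x. exp (- l * (s * x)) * bg_integral b c L (s * x)"
  have op: "open {x. s * x > 0}" by (intro open_Collect_less continuous_intros)
  \<comment> \<open>The sign \<open>s\<close> is 1 or -1, which covers both half-lines. The family
    \<open>?h c\<close> over all real \<open>c\<close> is closed under differentiation up to linear
    combinations.\<close>
  have der: "(?h c has_real_derivative (- l * s) * ?h c x + (s * (c - 1)) * ?h (c - 1) x) (at x)"
    if "x \<in> {x. s * x > 0}" for c x
  proof -
    have "((\<lambda>x. bg_integral b c L (s * x)) has_real_derivative (c - 1) * bg_integral b (c - 1) L (s * x) * s) (at x)"
      using that assms by (intro DERIV_chain2[OF bg_integral_has_derivative]) (auto intro!: derivative_eq_intros)
    then show ?thesis by (auto intro!: derivative_eq_intros simp: algebra_simps)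
  qed
  show ?thesis
  \<comment> \<open>The derivative involves \<open>c - 1\<close> besides \<open>c\<close>, hence the
    generalisation over \<open>c\<close>.\<close>
  proof (induction n arbitrary: c)
    case 0
    show ?case
      unfolding Cn_on_0
      by (intro continuous_at_imp_continuous_on ballI DERIV_isCont) (rule der)
  next
    case (Suc n)
    show ?case
      by (rule Cn_on_SucI[OF op der], assumption) (intro Cn_on_linear_combination op Suc.IH)
  qed
qed

lemma Cn_on_Un: "\<lbrakk>open S; open T; Cn_on n S f; Cn_on n T f\<rbrakk> \<Longrightarrow> Cn_on n (S \<union> T) f"
  by (auto simp: Cn_on_def intro: continuous_on_open_Un)

lemma bilateral_gamma_density_Cn_on_nonzero:
  assumes f: "is_bilateral_gamma_density a lp b lm f"
    and pos: "a > 0" "b > 0" "lp > 0" "lm > 0"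
  shows "Cn_on n (UNIV - {0}) f"
proof -
  have half: "Cn_on n {x. s * x > 0} (\<lambda>x. bilateral_gamma_formula a lp b lm (s * x))"
    if "s * s = 1" "a > 0" "b > 0" "lp > 0" "lm > 0" for a b lp lm s
  proof -
    have op: "open {x. s * x > 0}" by (intro open_Collect_less continuous_intros)
    have h: "Cn_on n {x. s * x > 0} (\<lambda>x. exp (- lp * (s * x)) * bg_integral b a (lp + lm) (s * x))"
      using that by (intro Cn_on_bg_integral) auto
    \<comment> \<open>A constant multiple is a linear combination with second coefficient 0.\<close>
    show ?thesis
      using Cn_on_linear_combination[OF op h h, of "lp powr a * lm powr b / ((lp + lm) powr b * Gamma a * Gamma b)" 0]
      by (simp add: bilateral_gamma_formula_eq mult.assoc)
  qed
  have "Cn_on n {0<..} f"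
  proof (subst Cn_on_cong[where g = "bilateral_gamma_formula a lp b lm"])
    show "Cn_on n {0<..} (bilateral_gamma_formula a lp b lm)"
      using half[of 1 a b lp lm] pos by (simp add: greaterThan_def)
  qed (use f in \<open>auto simp: is_bilateral_gamma_density_def\<close>)
  moreover have "Cn_on n {..<0} f"
  proof (subst Cn_on_cong[where g = "\<lambda>x. bilateral_gamma_formula b lm a lp (- x)"])
    show "Cn_on n {..<0} (\<lambda>x. bilateral_gamma_formula b lm a lp (- x))"
      using half[of "- 1" b a lm lp] pos by (simp add: lessThan_def)
  qed (use f in \<open>auto simp: is_bilateral_gamma_density_def\<close>)
  moreover have "UNIV - {0 :: real} = {0<..} \<union> {..<0}" by auto
  ultimately show ?thesis by (simp add: Cn_on_Un)
qed

section \<open>Induction on the order of smoothness\<close>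

lemma bilateral_gamma_density_sharp_Cn:
  assumes "is_bilateral_gamma_density a lp b lm f"
    and pos: "lp > 0" "lm > 0" and "a > 0" "b > 0" "real n < a + b" "a + b \<le> real n + 1"
  shows "sharp_Cn n f"
  using assms(1,4-)
proof (induction n arbitrary: a b f)
  case 0
  then have "\<not> isCont f 0"
    using bilateral_gamma_density_not_isCont_0 pos by simp
  then show ?case
    by (auto simp: sharp_Cn_def Cn_on_0 continuous_on_eq_continuous_at)
next
  case (Suc n)
  note f = \<open>is_bilateral_gamma_density a lp b lm f\<close>
  have cont: "isCont f 0"
    using bilateral_gamma_density_isCont_0[OF f] Suc.prems pos by simp
  \<comment> \<open>Lowering a shape above 1 by one keeps it positive and lowers both the sum of the
    shapes and the order by one, as the induction hypothesis requires.\<close>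
  consider "a > 1" | "b > 1" | "a \<le> 1" "b \<le> 1" by linarith
  then show ?case
  proof cases
    case 1
    obtain g where g: "is_bilateral_gamma_density (a - 1) lp b lm g"
      using is_bilateral_gamma_density_exists by blast
    show ?thesis
    proof (rule sharp_Cn_Suc[of lp, OF _ _ cont])
      show "(f has_real_derivative lp * (g x - f x)) (at x)" if "x \<noteq> 0" for x
        using bilateral_gamma_density_has_derivative[OF f g] 1 Suc.prems pos that by blast
      show "g 0 = l" if "(g \<longlongrightarrow> l) (at 0)" for l
        using g that by (simp add: is_bilateral_gamma_density_def)
      show "sharp_Cn n g"
        using Suc.IH[OF g] 1 Suc.prems by simp
    qed (use pos in auto)
  next
    case 2
    obtain g where g: "is_bilateral_gamma_density a lp (b - 1) lm g"
      using is_bilateral_gamma_density_exists by blast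
    note g' = is_bilateral_gamma_density_reflect[OF g] and f' = is_bilateral_gamma_density_reflect[OF f]
    show ?thesis
    \<comment> \<open>Reflection reverses the sign of the derivative, so the rate of the second
      component enters as \<open>- lm\<close>.\<close>
    proof (rule sharp_Cn_Suc[of "- lm", OF _ _ cont])
      show "(f has_real_derivative - lm * (g x - f x)) (at x)" if "x \<noteq> 0" for x
      proof -
        have "((\<lambda>x. f (- x)) has_real_derivative - (- lm * (g x - f x))) (at (- x))"
          using bilateral_gamma_density_has_derivative[OF f' g', of "- x"] 2 Suc.prems pos that by simp
        then show ?thesis by (subst (asm) DERIV_mirror) simp
      qed
      show "g 0 = l" if "(g \<longlongrightarrow> l) (at 0)" for l
        using g that by (simp add: is_bilateral_gamma_density_def)
      show "sharp_Cn n g"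
        using Suc.IH[OF g] 2 Suc.prems by simp
    qed (use pos in auto)
  next
    case 3
    \<comment> \<open>Both shapes are at most 1, so
      \<open>real (Suc n) < a + b <= 2\<close>.\<close>
    then have "n = 0" using Suc.prems by simp
    have "\<not> Cn_on 1 UNIV f"
      using bilateral_gamma_density_not_differentiable_0[OF f] 3 Suc.prems pos
      by (auto simp: Cn_on_Suc)
    moreover have "Cn_on 0 UNIV f"
    proof -
      have "Cn_on 0 (UNIV - {0}) f"
        using bilateral_gamma_density_Cn_on_nonzero[OF f] Suc.prems pos by simp
      then have "isCont f x" if "x \<noteq> 0" for x
        using that by (simp add: Cn_on_0 continuous_on_eq_continuous_at open_delete)
      then show ?thesis
        using cont by (metis Cn_on_0 continuous_at_imp_continuous_on)
    qed
    ultimately show ?thesis using \<open>n = 0\<close> by (simp add: sharp_Cn_def)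
  qed
qed

theorem theorem4p1:
  fixes ap lp am lm :: real and f :: "real \<Rightarrow> real" and N :: nat
  assumes "ap > 0" and "lp > 0" and "am > 0" and "lm > 0"
    and "is_bilateral_gamma_density ap lp am lm f"
    and "real N < ap + am" and "ap + am \<le> real N + 1"
  shows "Cn_on N (UNIV - {0}) f \<and>
         (N \<ge> 1 \<longrightarrow> Cn_on (N - 1) UNIV f) \<and> \<not> Cn_on N UNIV f"
  using bilateral_gamma_density_Cn_on_nonzero[of ap lp am lm f N]
    bilateral_gamma_density_sharp_Cn[of ap lp am lm f N] assms
  by (simp add: sharp_Cn_def)

end
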